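(* The pushout of the diagram $1\leftarrow2\to1$ (where $2=1+1$) is not representable in the category $\mathcal{S}_\pi$ of $\pi$-finite spaces; that is, this diagram has no pushout in $\mathcal{S}_\pi$.
   Context: "Category" means $(\infty,1)$-category, and pushouts are $\infty$-categorical. A space $X$ is $\pi$-finite if $\pi_0(X)$ is a finite set, all $\pi_n(X,x)$ ($n>0$) are finite groups for every choice of base point $x$, and $X$ is $n$-truncated for some $n$. $\mathcal{S}_\pi$ is the full subcategory of the category of spaces on the $\pi$-finite spaces; $1$ is the point. *)

theory Defs
  imports Main "HOL-Library.FuncSet"
begin

text \<open>
  The \<open>\<infinity>\<close>-category of spaces is modelled by the simplicially enriched category of Kan complexes:
  objects are Kan complexes, the mapping space from \<open>X\<close> to \<open>Y\<close> is the internal hom of simplicial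
  sets. All invariants below (homotopy groups, mapping spaces, homotopy pullbacks, equivalences)
  are the usual combinatorial ones for Kan complexes.
\<close>

section \<open>Simplicial sets\<close>

text \<open>
  A monotone map \<open>\<theta> : [m] \<rightarrow> [n]\<close> of the simplex category is encoded by the list
  \<open>[\<theta> 0, \<dots>, \<theta> m]\<close> of its values.
\<close>

definition mono_maps :: "nat \<Rightarrow> nat \<Rightarrow> nat list set" where
  "mono_maps m n = {\<theta>. length \<theta> = Suc m \<and> sorted \<theta> \<and> set \<theta> \<subseteq> {..n}}"

definition mono_id :: "nat \<Rightarrow> nat list" where
  "mono_id n = [0..<Suc n]"

definition mono_comp :: "nat list \<Rightarrow> nat list \<Rightarrow> nat list" where
  "mono_comp \<theta> \<phi> = map (\<lambda>i. \<theta> ! i) \<phi>"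

text \<open>The constant map \<open>[m] \<rightarrow> [n]\<close> with value \<open>i\<close>, and the coface map \<open>[n - 1] \<rightarrow> [n]\<close> omitting \<open>i\<close>.\<close>

definition mono_const :: "nat \<Rightarrow> nat \<Rightarrow> nat list" where
  "mono_const m i = replicate (Suc m) i"

definition coface :: "nat \<Rightarrow> nat \<Rightarrow> nat list" where
  "coface n i = [0..<i] @ [Suc i..<Suc n]"

text \<open>
  \<open>act X n \<theta> x\<close> is \<open>\<theta>\<^sup>* x\<close> for an \<open>n\<close>-simplex \<open>x\<close>. The dimension \<open>n\<close> is an argument because
  the sets of simplices of different dimensions need not be disjoint.
\<close>

record 'a sset =
  splx :: "nat \<Rightarrow> 'a set"
  act :: "nat \<Rightarrow> nat list \<Rightarrow> 'a \<Rightarrow> 'a"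

definition simplicial_set :: "'a sset \<Rightarrow> bool" where
  "simplicial_set X \<longleftrightarrow>
     (\<forall>m n. \<forall>\<theta>\<in>mono_maps m n. \<forall>x\<in>splx X n. act X n \<theta> x \<in> splx X m) \<and>
     (\<forall>n. \<forall>x\<in>splx X n. act X n (mono_id n) x = x) \<and>
     (\<forall>k m n. \<forall>\<phi>\<in>mono_maps k m. \<forall>\<theta>\<in>mono_maps m n. \<forall>x\<in>splx X n.
        act X n (mono_comp \<theta> \<phi>) x = act X m \<phi> (act X n \<theta> x))"

text \<open>
  Simplicial maps. Components are \<open>undefined\<close> off the simplices, so that equality of elements of
  \<open>smap X Y\<close> is equality of simplicial maps.
\<close>

definition smap :: "'a sset \<Rightarrow> 'b sset \<Rightarrow> (nat \<Rightarrow> 'a \<Rightarrow> 'b) set" where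
  "smap X Y = {f. (\<forall>n. f n \<in> splx X n \<rightarrow>\<^sub>E splx Y n) \<and>
     (\<forall>m n. \<forall>\<theta>\<in>mono_maps m n. \<forall>x\<in>splx X n. f m (act X n \<theta> x) = act Y n \<theta> (f n x))}"

definition std_simplex :: "nat \<Rightarrow> nat list sset" where
  "std_simplex n = \<lparr> splx = (\<lambda>k. mono_maps k n), act = (\<lambda>k \<phi> \<sigma>. mono_comp \<sigma> \<phi>) \<rparr>"

text \<open>\<open>horn n i\<close>: the union of all faces \<open>d_j\<close> of \<open>std_simplex n\<close> with \<open>j \<noteq> i\<close>.\<close>

definition horn :: "nat \<Rightarrow> nat \<Rightarrow> nat list sset" where
  "horn n i = \<lparr> splx = (\<lambda>k. {\<sigma> \<in> mono_maps k n. \<exists>j\<le>n. j \<noteq> i \<and> j \<notin> set \<sigma>}),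
                act = (\<lambda>k \<phi> \<sigma>. mono_comp \<sigma> \<phi>) \<rparr>"

definition sprod :: "'a sset \<Rightarrow> 'b sset \<Rightarrow> ('a \<times> 'b) sset" where
  "sprod X Y = \<lparr> splx = (\<lambda>n. splx X n \<times> splx Y n),
                 act = (\<lambda>n \<theta> (x, y). (act X n \<theta> x, act Y n \<theta> y)) \<rparr>"

definition discrete :: "'a set \<Rightarrow> 'a sset" where
  "discrete S = \<lparr> splx = (\<lambda>n. S), act = (\<lambda>n \<theta> x. x) \<rparr>"

definition discrete_map :: "'a set \<Rightarrow> ('a \<Rightarrow> 'b) \<Rightarrow> nat \<Rightarrow> 'a \<Rightarrow> 'b" where
  "discrete_map S f = (\<lambda>n. restrict f S)"

section \<open>Kan complexes and \<open>\<pi>\<close>-finite spaces\<close>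

definition kan_complex :: "'a sset \<Rightarrow> bool" where
  "kan_complex X \<longleftrightarrow> simplicial_set X \<and>
     (\<forall>n\<ge>1. \<forall>i\<le>n. \<forall>f\<in>smap (horn n i) X. \<exists>g\<in>smap (std_simplex n) X.
        \<forall>k. \<forall>\<sigma>\<in>splx (horn n i) k. g k \<sigma> = f k \<sigma>)"

definition face :: "'a sset \<Rightarrow> nat \<Rightarrow> nat \<Rightarrow> 'a \<Rightarrow> 'a" where
  "face X n i x = act X n (coface n i) x"

definition degenerate_at :: "'a sset \<Rightarrow> nat \<Rightarrow> 'a \<Rightarrow> 'a" where
  "degenerate_at X n x = act X 0 (mono_const n 0) x"

definition components :: "'a sset \<Rightarrow> 'a set set" where
  "components X = splx X 0 // {(x, y). x \<in> splx X 0 \<and> y \<in> splx X 0 \<and>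
     (\<exists>e\<in>splx X 1. face X 1 1 e = x \<and> face X 1 0 e = y)}"

text \<open>
  For \<open>n \<ge> 1\<close>, the underlying set of the homotopy group \<open>\<pi>\<^sub>n(X, x)\<close> of a Kan complex: \<open>n\<close>-simplices
  all of whose faces are degenerate at \<open>x\<close>, where \<open>s\<close> and \<open>t\<close> are identified if some
  \<open>(n+1)\<close>-simplex has last two faces \<open>s\<close> and \<open>t\<close> and all other faces degenerate at \<open>x\<close>.
\<close>

definition spheres :: "'a sset \<Rightarrow> nat \<Rightarrow> 'a \<Rightarrow> 'a set" where
  "spheres X n x = {s \<in> splx X n. \<forall>i\<le>n. face X n i s = degenerate_at X (n - 1) x}"

definition sphere_rel :: "'a sset \<Rightarrow> nat \<Rightarrow> 'a \<Rightarrow> ('a \<times> 'a) set" where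
  "sphere_rel X n x = {(s, t). s \<in> spheres X n x \<and> t \<in> spheres X n x \<and>
     (\<exists>y\<in>splx X (Suc n). face X (Suc n) n y = s \<and> face X (Suc n) (Suc n) y = t \<and>
        (\<forall>i<n. face X (Suc n) i y = degenerate_at X n x))}"

definition homotopy_group :: "'a sset \<Rightarrow> nat \<Rightarrow> 'a \<Rightarrow> 'a set set" where
  "homotopy_group X n x = spheres X n x // sphere_rel X n x"

definition truncated :: "nat \<Rightarrow> 'a sset \<Rightarrow> bool" where
  "truncated n X \<longleftrightarrow> (\<forall>k>n. \<forall>x\<in>splx X 0. is_singleton (homotopy_group X k x))"

text \<open>
  The objects of the full subcategory of \<open>\<pi>\<close>-finite spaces, with simplices taken from \<open>'u\<close>.
  Every \<open>\<pi>\<close>-finite space is equivalent to a Kan complex with countably many simplices, so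
  for each infinite type \<open>'u\<close> all \<open>\<pi>\<close>-finite spaces are represented up to equivalence.
\<close>

definition pi_finite_spaces :: "'u sset set" where
  "pi_finite_spaces = {X. kan_complex X \<and> finite (components X) \<and>
     (\<forall>n\<ge>1. \<forall>x\<in>splx X 0. finite (homotopy_group X n x)) \<and>
     (\<exists>n. truncated n X)}"

section \<open>Mapping spaces and equivalences\<close>

definition mapping_space :: "'a sset \<Rightarrow> 'b sset \<Rightarrow> (nat \<Rightarrow> 'a \<times> nat list \<Rightarrow> 'b) sset" where
  "mapping_space X Y =
     \<lparr> splx = (\<lambda>n. smap (sprod X (std_simplex n)) Y),
       act = (\<lambda>n \<theta> u k. restrict (\<lambda>(x, \<sigma>). u k (x, mono_comp \<theta> \<sigma>))
                          (splx (sprod X (std_simplex (length \<theta> - 1))) k)) \<rparr>"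

text \<open>The \<open>n\<close>-simplex \<open>f\<^sup>* u\<close> of \<open>mapping_space X Z\<close>, for \<open>f : X \<rightarrow> Y\<close> and \<open>u\<close> in \<open>mapping_space Y Z\<close>.\<close>

definition precomp ::
    "'a sset \<Rightarrow> (nat \<Rightarrow> 'a \<Rightarrow> 'b) \<Rightarrow> nat \<Rightarrow> (nat \<Rightarrow> 'b \<times> nat list \<Rightarrow> 'c) \<Rightarrow> nat \<Rightarrow> 'a \<times> nat list \<Rightarrow> 'c" where
  "precomp X f n u = (\<lambda>k. restrict (\<lambda>(x, \<sigma>). u k (f k x, \<sigma>)) (splx (sprod X (std_simplex n)) k))"

text \<open>The inclusion \<open>X \<times> {e} \<rightarrow> X \<times> \<Delta>\<^sup>1\<close> for \<open>e = 0, 1\<close>.\<close>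

definition cyl_end :: "'a sset \<Rightarrow> nat \<Rightarrow> nat \<Rightarrow> 'a \<Rightarrow> 'a \<times> nat list" where
  "cyl_end X e = (\<lambda>k. \<lambda>x\<in>splx X k. (x, mono_const k e))"

definition homotopy_between ::
    "'a sset \<Rightarrow> 'b sset \<Rightarrow> (nat \<Rightarrow> 'a \<times> nat list \<Rightarrow> 'b) \<Rightarrow> (nat \<Rightarrow> 'a \<Rightarrow> 'b) \<Rightarrow> (nat \<Rightarrow> 'a \<Rightarrow> 'b) \<Rightarrow> bool" where
  "homotopy_between X Y h f g \<longleftrightarrow> h \<in> smap (sprod X (std_simplex 1)) Y \<and>
     (\<forall>k. \<forall>x\<in>splx X k. h k (cyl_end X 0 k x) = f k x \<and> h k (cyl_end X 1 k x) = g k x)"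

text \<open>
  This is the right notion of equivalence between Kan complexes; it is only applied to those (mapping
  spaces into a Kan complex, and homotopy pullbacks of them).
\<close>

definition homotopy_equivalence :: "'a sset \<Rightarrow> 'b sset \<Rightarrow> (nat \<Rightarrow> 'a \<Rightarrow> 'b) \<Rightarrow> bool" where
  "homotopy_equivalence X Y f \<longleftrightarrow> f \<in> smap X Y \<and>
     (\<exists>g\<in>smap Y X.
        (\<exists>h. homotopy_between X X h (\<lambda>k x. g k (f k x)) (\<lambda>k x. x)) \<and>
        (\<exists>h. homotopy_between Y Y h (\<lambda>k y. f k (g k y)) (\<lambda>k y. y)))"

section \<open>Pushouts\<close>

text \<open>
  The space of homotopy coherent cocones with vertex \<open>X\<close> under a span
  \<open>A \<leftarrow> C \<rightarrow> B\<close> (left leg \<open>f\<close>, right leg \<open>g\<close>), that is, the homotopy pullback of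
  \<open>Map(A, X) \<rightarrow> Map(C, X) \<leftarrow> Map(B, X)\<close>. It is computed in the standard way as
  \<open>Map(A, X) \<times>\<^bsub>Map(C, X)\<^esub> Map(C, X)\<^bsup>\<Delta>1\<^esup> \<times>\<^bsub>Map(C, X)\<^esub> Map(B, X)\<close>, where the
  path space \<open>Map(C, X)\<^bsup>\<Delta>1\<^esup>\<close> is \<open>Map(C \<times> \<Delta>1, X)\<close>.
\<close>

definition cocone_space ::
    "'c sset \<Rightarrow> 'a sset \<Rightarrow> 'b sset \<Rightarrow> (nat \<Rightarrow> 'c \<Rightarrow> 'a) \<Rightarrow> (nat \<Rightarrow> 'c \<Rightarrow> 'b) \<Rightarrow> 'x sset \<Rightarrow>
     ((nat \<Rightarrow> 'a \<times> nat list \<Rightarrow> 'x) \<times> (nat \<Rightarrow> ('c \<times> nat list) \<times> nat list \<Rightarrow> 'x) \<times>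
      (nat \<Rightarrow> 'b \<times> nat list \<Rightarrow> 'x)) sset" where
  "cocone_space C A B f g X =
     \<lparr> splx = (\<lambda>n. {(u, w, v).
          u \<in> splx (mapping_space A X) n \<and>
          w \<in> splx (mapping_space (sprod C (std_simplex 1)) X) n \<and>
          v \<in> splx (mapping_space B X) n \<and>
          precomp C (cyl_end C 0) n w = precomp C f n u \<and>
          precomp C (cyl_end C 1) n w = precomp C g n v}),
       act = (\<lambda>n \<theta> (u, w, v).
          (act (mapping_space A X) n \<theta> u,
           act (mapping_space (sprod C (std_simplex 1)) X) n \<theta> w,
           act (mapping_space B X) n \<theta> v)) \<rparr>"

text \<open>The map \<open>Map(P, X) \<rightarrow> cocone_space C A B f g X\<close> induced by a cocone \<open>(a, h, b)\<close> with vertex \<open>P\<close>.\<close>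

definition cocone_comparison ::
    "'c sset \<Rightarrow> 'a sset \<Rightarrow> 'b sset \<Rightarrow> 'p sset \<Rightarrow>
     (nat \<Rightarrow> 'a \<Rightarrow> 'p) \<Rightarrow> (nat \<Rightarrow> 'c \<times> nat list \<Rightarrow> 'p) \<Rightarrow> (nat \<Rightarrow> 'b \<Rightarrow> 'p) \<Rightarrow> 'x sset \<Rightarrow>
     nat \<Rightarrow> (nat \<Rightarrow> 'p \<times> nat list \<Rightarrow> 'x) \<Rightarrow>
     (nat \<Rightarrow> 'a \<times> nat list \<Rightarrow> 'x) \<times> (nat \<Rightarrow> ('c \<times> nat list) \<times> nat list \<Rightarrow> 'x) \<times>
     (nat \<Rightarrow> 'b \<times> nat list \<Rightarrow> 'x)" where
  "cocone_comparison C A B P a h b X = (\<lambda>n. \<lambda>u\<in>splx (mapping_space P X) n.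
     (precomp A a n u, precomp (sprod C (std_simplex 1)) h n u, precomp B b n u))"

text \<open>
  \<open>P\<close> with legs \<open>a\<close>, \<open>b\<close> and a homotopy \<open>h\<close> from \<open>a \<circ> f\<close> to \<open>b \<circ> g\<close> is a pushout in the full
  subcategory of spaces on \<open>\<C>\<close>: for every \<open>X\<close> in \<open>\<C>\<close>, \<open>Map(P, X)\<close> is identified by restriction
  with the space of cocones with vertex \<open>X\<close>.
\<close>

definition is_pushout_in ::
    "'u sset set \<Rightarrow> 'u sset \<Rightarrow> 'u sset \<Rightarrow> 'u sset \<Rightarrow> (nat \<Rightarrow> 'u \<Rightarrow> 'u) \<Rightarrow> (nat \<Rightarrow> 'u \<Rightarrow> 'u) \<Rightarrow>
     'u sset \<Rightarrow> (nat \<Rightarrow> 'u \<Rightarrow> 'u) \<Rightarrow> (nat \<Rightarrow> 'u \<times> nat list \<Rightarrow> 'u) \<Rightarrow> (nat \<Rightarrow> 'u \<Rightarrow> 'u) \<Rightarrow> bool" where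
  "is_pushout_in \<C> C A B f g P a h b \<longleftrightarrow>
     P \<in> \<C> \<and> a \<in> smap A P \<and> b \<in> smap B P \<and>
     homotopy_between C P h (\<lambda>k c. a k (f k c)) (\<lambda>k c. b k (g k c)) \<and>
     (\<forall>X\<in>\<C>. homotopy_equivalence (mapping_space P X) (cocone_space C A B f g X)
               (cocone_comparison C A B P a h b X))"

definition has_pushout_in ::
    "'u sset set \<Rightarrow> 'u sset \<Rightarrow> 'u sset \<Rightarrow> 'u sset \<Rightarrow> (nat \<Rightarrow> 'u \<Rightarrow> 'u) \<Rightarrow> (nat \<Rightarrow> 'u \<Rightarrow> 'u) \<Rightarrow> bool" where
  "has_pushout_in \<C> C A B f g \<longleftrightarrow> (\<exists>P a h b. is_pushout_in \<C> C A B f g P a h b)"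

end

theory Submission
  imports Defs "HOL-Library.Countable"
begin

text \<open>
  A cocone with vertex \<open>X\<close> under \<open>1 \<leftarrow> 2 \<rightarrow> 1\<close> is a pair of parallel paths in \<open>X\<close>, that is, a free
  loop. If \<open>P\<close> were a pushout among \<open>\<pi>\<close>-finite spaces, with universal loop \<open>\<ell>\<close>, then for
  each \<open>M\<close> a loop generating \<open>\<pi>\<^sub>1\<close> of the \<open>\<pi>\<close>-finite space \<open>K(\<int>/M, 1)\<close> would be the image of
  \<open>\<ell>\<close> under some map \<open>P \<rightarrow> K(\<int>/M, 1)\<close>. Hence \<open>\<pi>\<^sub>1(P)\<close> would have at least \<open>M\<close> elements, which is
  absurd for \<open>M > \<bar>\<pi>\<^sub>1(P)\<bar>\<close>.
\<close>

section \<open>Simplicial sets\<close>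

lemma mono_mapsD:
  assumes "\<theta> \<in> mono_maps m n"
  shows "length \<theta> = Suc m" "sorted \<theta>" "set \<theta> \<subseteq> {..n}" "\<theta> \<noteq> []"
  using assms by (auto simp: mono_maps_def)

lemma mono_comp_in:
  assumes "\<theta> \<in> mono_maps m n" "\<phi> \<in> mono_maps k m"
  shows "mono_comp \<theta> \<phi> \<in> mono_maps k n"
proof -
  have "\<theta> ! (\<phi> ! i) \<le> \<theta> ! (\<phi> ! j)" if "i \<le> j" "j < length \<phi>" for i j
  proof -
    have "\<phi> ! j \<in> set \<phi>" using that by simp
    then have "\<phi> ! j < length \<theta>"
      using mono_mapsD[OF assms(1)] mono_mapsD[OF assms(2)] by auto
    moreover have "\<phi> ! i \<le> \<phi> ! j"
      using that mono_mapsD(2)[OF assms(2)] by (simp add: sorted_nth_mono)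
    ultimately show ?thesis
      using mono_mapsD(2)[OF assms(1)] by (simp add: sorted_nth_mono)
  qed
  then have "sorted (mono_comp \<theta> \<phi>)"
    by (auto simp: mono_comp_def sorted_iff_nth_mono)
  moreover have "\<theta> ! i \<le> n" if "i \<in> set \<phi>" for i
  proof -
    have "i < length \<theta>" using that mono_mapsD[OF assms(1)] mono_mapsD[OF assms(2)] by auto
    then have "\<theta> ! i \<in> set \<theta>" by simp
    then show ?thesis using mono_mapsD(3)[OF assms(1)] by auto
  qed
  ultimately show ?thesis
    using mono_mapsD[OF assms(2)] by (auto simp: mono_maps_def mono_comp_def)
qed

lemma set_coface: "i \<le> n \<Longrightarrow> set (coface n i) = {..n} - {i}"
  by (auto simp: coface_def)

lemma coface_in: "0 < n \<Longrightarrow> i \<le> n \<Longrightarrow> coface n i \<in> mono_maps (n - 1) n"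
  by (auto simp: mono_maps_def coface_def sorted_append)

lemma smap_in: "f \<in> smap X Y \<Longrightarrow> x \<in> splx X n \<Longrightarrow> f n x \<in> splx Y n"
  by (auto simp: smap_def)

lemma smap_act:
  "f \<in> smap X Y \<Longrightarrow> \<theta> \<in> mono_maps m n \<Longrightarrow> x \<in> splx X n \<Longrightarrow>
    f m (act X n \<theta> x) = act Y n \<theta> (f n x)"
  by (auto simp: smap_def)

lemma simplicial_set_act_in:
  "simplicial_set X \<Longrightarrow> \<theta> \<in> mono_maps m n \<Longrightarrow> x \<in> splx X n \<Longrightarrow> act X n \<theta> x \<in> splx X m"
  by (auto simp: simplicial_set_def)

lemma simplicial_set_act_act:
  "simplicial_set X \<Longrightarrow> \<phi> \<in> mono_maps k m \<Longrightarrow> \<theta> \<in> mono_maps m n \<Longrightarrow> x \<in> splx X n \<Longrightarrow>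
    act X m \<phi> (act X n \<theta> x) = act X n (mono_comp \<theta> \<phi>) x"
  by (auto simp: simplicial_set_def)

lemma simplicial_set_act_id:
  "simplicial_set X \<Longrightarrow> x \<in> splx X n \<Longrightarrow> act X n (mono_id n) x = x"
  by (auto simp: simplicial_set_def)

lemma coface_2: "coface 2 0 = [1, 2]" "coface 2 1 = [0, 2]" "coface 2 2 = [0, 1]"
  by (simp_all add: coface_def eval_nat_numeral)

lemma coface_1: "coface (Suc 0) 0 = [1]" "coface (Suc 0) (Suc 0) = [0]"
  by (simp_all add: coface_def)

section \<open>Classifying space of a cyclic group\<close>

text \<open>
  An \<open>n\<close>-simplex of the nerve of \<open>\<int>/M\<close> is a labelling of the vertices by residues, up to
  translation; it is represented by the labelling with first entry \<open>0\<close>. The injection \<open>e\<close> serves to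
  place these lists in an arbitrary infinite type.
\<close>

definition normalize_labels :: "int \<Rightarrow> int list \<Rightarrow> int list" where
  "normalize_labels M xs = map (\<lambda>x. (x - hd xs) mod M) xs"

definition cyclic_nerve :: "(int list \<Rightarrow> 'u) \<Rightarrow> int \<Rightarrow> 'u sset" where
  "cyclic_nerve e M = \<lparr> splx = (\<lambda>n. e ` {xs. length xs = Suc n \<and> normalize_labels M xs = xs}),
     act = (\<lambda>n \<theta> x. e (normalize_labels M (map (\<lambda>i. inv e x ! i) \<theta>))) \<rparr>"

text \<open>The list encoding an edge is \<open>[0, d]\<close>, so this entry is the element
  \<open>d\<close> of \<int>/M that the edge carries.\<close>

definition edge_label :: "(int list \<Rightarrow> 'u) \<Rightarrow> 'u \<Rightarrow> int" where
  "edge_label e x = inv e x ! 1"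

lemma length_normalize [simp]: "length (normalize_labels M xs) = length xs"
  by (simp add: normalize_labels_def)

lemma normalize_nth:
  "i < length xs \<Longrightarrow> normalize_labels M xs ! i = (xs ! i - xs ! 0) mod M"
  by (cases "xs = []") (auto simp: normalize_labels_def hd_conv_nth)

lemma normalize_idem [simp]:
  "normalize_labels M (normalize_labels M xs) = normalize_labels M xs"
proof (rule nth_equalityI)
  fix i assume "i < length (normalize_labels M (normalize_labels M xs))"
  then have "i < length xs" "0 < length xs" by auto
  then show "normalize_labels M (normalize_labels M xs) ! i = normalize_labels M xs ! i"
    by (simp add: normalize_nth)
qed simp

text \<open>Normalizing shifts all labels by one constant modulo \<open>M\<close>, and the outer
  normalization only sees differences.\<close>

lemma normalize_reindex:
  assumes "set \<theta> \<subseteq> {..<length xs}"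
  shows "normalize_labels M (map ((!) (normalize_labels M xs)) \<theta>) =
         normalize_labels M (map ((!) xs) \<theta>)"
proof (rule nth_equalityI)
  fix i assume "i < length (normalize_labels M (map ((!) (normalize_labels M xs)) \<theta>))"
  then have i: "i < length \<theta>" by simp
  then have "0 < length \<theta>" by linarith
  with i have "\<theta> ! i \<in> set \<theta>" "\<theta> ! 0 \<in> set \<theta>" by simp_all
  then have "\<theta> ! i < length xs" "\<theta> ! 0 < length xs" using assms by auto
  then show "normalize_labels M (map ((!) (normalize_labels M xs)) \<theta>) ! i =
      normalize_labels M (map ((!) xs) \<theta>) ! i"
    using i \<open>0 < length \<theta>\<close> by (simp add: normalize_nth mod_diff_eq)
qed simp

lemma normalize_const:
  assumes "\<And>i. i \<in> set \<sigma> \<Longrightarrow> v i = c"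
  shows "normalize_labels M (map v \<sigma>) = replicate (length \<sigma>) 0"
proof -
  have "map v \<sigma> = replicate (length \<sigma>) c"
    using assms by (induction \<sigma>) auto
  moreover have "normalize_labels M (replicate k c) = replicate k 0" for k
    by (cases k) (simp_all add: normalize_labels_def)
  ultimately show ?thesis by metis
qed

locale label_encoding =
  fixes e :: "int list \<Rightarrow> 'u" and M :: int
  assumes inj_e: "inj e" and M_pos: "M > 0"
begin

abbreviation "X \<equiv> cyclic_nerve e M"

lemma inv_e [simp]: "inv e (e xs) = xs"
  using inj_e by simp

lemma splx_iff: "x \<in> splx X n \<longleftrightarrow> (\<exists>xs. x = e xs \<and> length xs = Suc n \<and> normalize_labels M xs = xs)"
  by (auto simp: cyclic_nerve_def)

lemma simplex_in: "length \<sigma> = Suc n \<Longrightarrow> e (normalize_labels M (map v \<sigma>)) \<in> splx X n"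
  by (auto simp: splx_iff)

lemma act_eq: "act X n \<theta> x = e (normalize_labels M (map ((!) (inv e x)) \<theta>))"
  by (simp add: cyclic_nerve_def)

text \<open>This is naturality in \<open>\<sigma>\<close>: a vertex labelling \<open>v\<close>,
  normalized or not, defines a simplicial map into \<open>X\<close>. The maps into \<open>X\<close>
  constructed below are simplicial for this reason.\<close>

lemma act_simplex:
  assumes "length \<sigma> = Suc n" "\<theta> \<in> mono_maps m n"
  shows "act X n \<theta> (e (normalize_labels M (map v \<sigma>))) = e (normalize_labels M (map v (mono_comp \<sigma> \<theta>)))"
proof -
  have *: "set \<theta> \<subseteq> {..<length (map v \<sigma>)}"
    using mono_mapsD[OF assms(2)] assms(1) by auto
  have "map ((!) (map v \<sigma>)) \<theta> = map v (mono_comp \<sigma> \<theta>)"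
    using * by (auto simp: mono_comp_def)
  with normalize_reindex[OF *, of M] show ?thesis by (simp add: act_eq)
qed

lemma simplicial_set_X: "simplicial_set X"
  unfolding simplicial_set_def
proof (intro conjI allI ballI)
  fix m n \<theta> x assume "\<theta> \<in> mono_maps m n" "x \<in> splx X n"
  then show "act X n \<theta> x \<in> splx X m"
    by (auto simp: act_eq dest: mono_mapsD intro!: simplex_in)
next
  fix n x assume "x \<in> splx X n"
  then obtain xs where xs: "x = e xs" "length xs = Suc n" "normalize_labels M xs = xs"
    by (auto simp: splx_iff)
  have "map ((!) xs) (mono_id n) = xs"
    unfolding mono_id_def xs(2)[symmetric] by (rule map_nth)
  then show "act X n (mono_id n) x = x" using xs by (simp add: act_eq)
next
  fix k m n \<phi> \<theta> x
  assume *: "\<phi> \<in> mono_maps k m" "\<theta> \<in> mono_maps m n" "x \<in> splx X n"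
  then have "length \<theta> = Suc m" by (auto dest: mono_mapsD)
  then show "act X n (mono_comp \<theta> \<phi>) x = act X m \<phi> (act X n \<theta> x)"
    using act_simplex[of \<theta> m \<phi> k "(!) (inv e x)"] * by (simp add: act_eq)
qed

section \<open>Edge labels and the Kan condition\<close>

lemma edge_label_act:
  "i \<le> j \<Longrightarrow> j \<le> n \<Longrightarrow> edge_label e (act X n [i, j] x) = (inv e x ! j - inv e x ! i) mod M"
  by (simp add: edge_label_def act_eq normalize_labels_def)

text \<open>Labels are differences of vertex labels, and these telescope along a triangle.\<close>

lemma edge_label_cocycle:
  "edge_label e (act X 2 [0,2] x) mod M =
         (edge_label e (act X 2 [0,1] x) + edge_label e (act X 2 [1,2] x)) mod M"
  by (simp add: edge_label_act mod_simps)

lemma kan_complex_X: "kan_complex X"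
  unfolding kan_complex_def
proof (intro conjI allI impI ballI simplicial_set_X)
  fix n i :: nat and f
  assume n: "1 \<le> n" and i: "i \<le> n" and f: "f \<in> smap (horn n i) X"
  \<comment> \<open>The potential \<open>v\<close> is measured from the horn vertex \<open>i\<close>
    along edges, with reversed sign for edges running into \<open>i\<close>. For
    \<open>n = 1\<close> the edge joining \<open>i\<close> to the other vertex lies outside the
    horn, so \<open>f\<close> is \<open>undefined\<close> on it; any value of \<open>v\<close> there
    gives a filler.\<close>
  define v where "v j = (if i \<le> j then edge_label e (f 1 [i, j]) else - edge_label e (f 1 [j, i]))" for j
  define g where "g k = restrict (\<lambda>\<sigma>. e (normalize_labels M (map v \<sigma>))) (mono_maps k n)" for k
  have g: "g \<in> smap (std_simplex n) X"
    unfolding smap_def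
  proof (intro CollectI conjI allI ballI)
    show "g k \<in> splx (std_simplex n) k \<rightarrow>\<^sub>E splx X k" for k
      by (auto simp: g_def std_simplex_def dest: mono_mapsD intro!: simplex_in)
  next
    fix m k \<theta> \<sigma> assume *: "\<theta> \<in> mono_maps m k" "\<sigma> \<in> splx (std_simplex n) k"
    then show "g m (act (std_simplex n) k \<theta> \<sigma>) = act X k \<theta> (g k \<sigma>)"
      using act_simplex[of \<sigma> k \<theta> m v] mono_comp_in[of \<sigma> k n \<theta> m] mono_mapsD[of \<sigma> k n]
      by (simp add: g_def std_simplex_def)
  qed
  have label_f: "edge_label e (f 1 [\<sigma> ! a, \<sigma> ! b]) = (inv e (f k \<sigma>) ! b - inv e (f k \<sigma>) ! a) mod M"
    if "\<sigma> \<in> splx (horn n i) k" "a \<le> b" "b \<le> k" for \<sigma> k a b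
  proof -
    have "[a, b] \<in> mono_maps 1 k" using that by (auto simp: mono_maps_def)
    from smap_act[OF f this that(1)] have "f 1 [\<sigma> ! a, \<sigma> ! b] = act X k [a, b] (f k \<sigma>)"
      by (simp add: horn_def mono_comp_def)
    then show ?thesis using that by (simp add: edge_label_act)
  qed
  have triangle: "edge_label e (f 1 [a, c]) mod M =
      (edge_label e (f 1 [a, b]) + edge_label e (f 1 [b, c])) mod M"
    if "[a, b, c] \<in> splx (horn n i) 2" for a b c
    using label_f[OF that, of 0 1] label_f[OF that, of 1 2] label_f[OF that, of 0 2]
    by (simp add: mod_simps)
  \<comment> \<open>The face opposite \<open>j\<close> contains \<open>a\<close>, \<open>b\<close>
    and \<open>i\<close>, so their triangle lies in the horn and its cocycle relation gives the
    claim. The cases are the positions of \<open>i\<close> relative to \<open>a\<close> and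
    \<open>b\<close>.\<close>
  have edge_f: "edge_label e (f 1 [a, b]) mod M = (v b - v a) mod M"
    if ab: "a \<le> b" "b \<le> n" "j \<le> n" "j \<noteq> i" "j \<noteq> a" "j \<noteq> b" for a b j
  proof -
    consider "i \<le> a" | "a < i" "i \<le> b" | "b < i" by linarith
    then show ?thesis
    proof cases
      case 1
      then have "[i, a, b] \<in> splx (horn n i) 2"
        using ab by (auto simp: horn_def mono_maps_def)
      from mod_diff_cong[OF triangle[OF this] refl, of "edge_label e (f 1 [i, a])"]
      show ?thesis using 1 ab by (simp add: v_def)
    next
      case 2
      then have "[a, i, b] \<in> splx (horn n i) 2"
        using ab by (auto simp: horn_def mono_maps_def)
      from triangle[OF this] show ?thesis using 2 by (simp add: v_def add.commute)
    next
      case 3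
      then have "[a, b, i] \<in> splx (horn n i) 2"
        using ab i by (auto simp: horn_def mono_maps_def)
      from mod_diff_cong[OF triangle[OF this] refl, of "edge_label e (f 1 [b, i])"]
      show ?thesis using 3 ab by (simp add: v_def)
    qed
  qed
  have "g k \<sigma> = f k \<sigma>" if \<sigma>: "\<sigma> \<in> splx (horn n i) k" for k \<sigma>
  proof -
    obtain xs where xs: "f k \<sigma> = e xs" "length xs = Suc k" "normalize_labels M xs = xs"
      using smap_in[OF f \<sigma>] by (auto simp: splx_iff)
    from \<sigma> obtain j where \<sigma>': "\<sigma> \<in> mono_maps k n" and j: "j \<le> n" "j \<noteq> i" "j \<notin> set \<sigma>"
      by (auto simp: horn_def)
    \<comment> \<open>A normalized simplex is determined by the labels of the edges from its first
      vertex, so it suffices to compare these.\<close>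
    have "normalize_labels M (map v \<sigma>) = xs"
    proof (rule nth_equalityI)
      show "length (normalize_labels M (map v \<sigma>)) = length xs"
        using xs mono_mapsD[OF \<sigma>'] by simp
      fix m assume "m < length (normalize_labels M (map v \<sigma>))"
      then have m: "m < length \<sigma>" by simp
      then have m0: "0 < length \<sigma>" by linarith
      have mem: "\<sigma> ! m \<in> set \<sigma>" "\<sigma> ! 0 \<in> set \<sigma>" using m m0 by auto
      have le: "\<sigma> ! 0 \<le> \<sigma> ! m" using mono_mapsD(2)[OF \<sigma>'] m by (simp add: sorted_nth_mono)
      have "\<sigma> ! m \<le> n" "j \<noteq> \<sigma> ! m" "j \<noteq> \<sigma> ! 0" using mem mono_mapsD(3)[OF \<sigma>'] j by auto
      then have "edge_label e (f 1 [\<sigma> ! 0, \<sigma> ! m]) mod M = (v (\<sigma> ! m) - v (\<sigma> ! 0)) mod M"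
        using edge_f[of "\<sigma> ! 0" "\<sigma> ! m" j] le j by auto
      moreover have "edge_label e (f 1 [\<sigma> ! 0, \<sigma> ! m]) = (xs ! m - xs ! 0) mod M"
        using label_f[OF \<sigma>, of 0 m] m mono_mapsD(1)[OF \<sigma>'] xs by simp
      moreover have "xs ! m = (xs ! m - xs ! 0) mod M"
        using normalize_nth[of m xs M] xs m mono_mapsD(1)[OF \<sigma>'] by simp
      ultimately have "(v (\<sigma> ! m) - v (\<sigma> ! 0)) mod M = xs ! m"
        by (metis mod_mod_trivial)
      then show "normalize_labels M (map v \<sigma>) ! m = xs ! m"
        using m m0 by (simp add: normalize_nth)
    qed
    then show ?thesis using \<sigma>' xs by (simp add: g_def)
  qed
  with g show "\<exists>g\<in>smap (std_simplex n) X. \<forall>k. \<forall>\<sigma>\<in>splx (horn n i) k. g k \<sigma> = f k \<sigma>"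
    by blast
qed

section \<open>Homotopy groups of the classifying space\<close>

lemma finite_splx: "finite (splx X n)"
proof -
  have "set xs \<subseteq> {0..<M}" if "normalize_labels M xs = xs" for xs
  proof -
    have "set (normalize_labels M xs) \<subseteq> {0..<M}"
      using M_pos by (auto simp: normalize_labels_def)
    then show ?thesis using that by simp
  qed
  then have "splx X n \<subseteq> e ` {xs. set xs \<subseteq> {0..<M} \<and> length xs = Suc n}"
    by (auto simp: splx_iff)
  then show ?thesis
    by (rule finite_subset) (auto intro: finite_lists_length_eq)
qed

text \<open>Vertices \<open>0\<close> and \<open>m\<close> lie in a common face, which is degenerate
  and so forces equal labels on them. Only the constant simplex remains.\<close>

lemma spheres_trivial:
  assumes k: "1 < k" and x: "x \<in> splx X 0"
  shows "is_singleton (spheres X k x)"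
proof -
  obtain xs where xs: "x = e xs" "length xs = 1" "normalize_labels M xs = xs"
    using x by (auto simp: splx_iff)
  have deg: "degenerate_at X n x = e (replicate (Suc n) 0)" for n
    using normalize_const[of "mono_const n 0" "(!) xs" "xs ! 0" M] xs
    by (simp add: degenerate_at_def act_eq mono_const_def del: replicate_Suc)
  have "spheres X k x = {e (replicate (Suc k) 0)}"
  proof (intro equalityI subsetI)
    fix s assume s: "s \<in> spheres X k x"
    then obtain ys where ys: "s = e ys" "length ys = Suc k" "normalize_labels M ys = ys"
      by (auto simp: spheres_def splx_iff)
    have "ys ! m = 0" if m: "m \<le> k" for m
    proof -
      have nth: "ys ! m = (ys ! m - ys ! 0) mod M"
        using normalize_nth[of m ys M] ys m by simp
      \<comment> \<open>The vertex to omit is neither \<open>0\<close> nor \<open>m\<close>; there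
        is one because \<open>k\<close> is at least 2. The face then still starts at vertex
        \<open>0\<close>, so its labels are measured from \<open>ys ! 0\<close>.\<close>
      define i :: nat where "i = (if m = 1 then 2 else 1)"
      have i: "i \<le> k" "i \<noteq> 0" "i \<noteq> m" using k by (auto simp: i_def)
      have "e (normalize_labels M (map ((!) ys) (coface k i))) = e (replicate k 0)"
        using s i k ys by (auto simp: spheres_def face_def act_eq deg simp del: replicate_Suc)
      then have eq: "normalize_labels M (map ((!) ys) (coface k i)) = replicate k 0"
        using inj_e by (simp add: inj_eq)
      have "hd (map ((!) ys) (coface k i)) = ys ! 0"
        using i by (cases i) (auto simp: coface_def upt_rec)
      moreover have "m \<in> set (coface k i)" using set_coface i m by auto
      ultimately have "(ys ! m - ys ! 0) mod M \<in> set (normalize_labels M (map ((!) ys) (coface k i)))"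
        by (simp add: normalize_labels_def)
      then show ?thesis using nth eq by simp
    qed
    then have "ys = replicate (Suc k) 0"
      using ys by (intro nth_equalityI) (auto simp del: replicate_Suc)
    then show "s \<in> {e (replicate (Suc k) 0)}" using ys by simp
  next
    fix s assume "s \<in> {e (replicate (Suc k) 0)}"
    then have s: "s = degenerate_at X k x" by (simp add: deg del: replicate_Suc)
    have const: "mono_const k 0 \<in> mono_maps k 0" by (auto simp: mono_maps_def mono_const_def)
    have "act X k (coface k i) s = degenerate_at X (k - 1) x" if "i \<le> k" for i
    proof -
      have co: "coface k i \<in> mono_maps (k - 1) k" using coface_in that k by simp
      have "map ((!) (replicate (Suc k) 0)) (coface k i) = map (\<lambda>_. 0) (coface k i)"
        using mono_mapsD(3)[OF co] by (intro map_cong) (auto simp del: replicate_Suc simp: less_Suc_eq_le)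
      then have "mono_comp (mono_const k 0) (coface k i) = mono_const (k - 1) 0"
        using mono_mapsD(1)[OF co]
        by (simp add: mono_comp_def mono_const_def map_replicate_const del: replicate_Suc)
      then show ?thesis
        using simplicial_set_act_act[OF simplicial_set_X co const x] s by (simp add: degenerate_at_def)
    qed
    moreover have "s \<in> splx X k"
      using simplicial_set_act_in[OF simplicial_set_X const x] s by (simp add: degenerate_at_def)
    ultimately show "s \<in> spheres X k x" by (simp add: spheres_def face_def)
  qed
  then show ?thesis by simp
qed

text \<open>Components and homotopy groups are quotients of finite sets of simplices, and the
  truncation level is 1.\<close>

lemma pi_finite_X: "X \<in> pi_finite_spaces"
proof -
  have "finite (components X)"
    unfolding components_def quotient_def using finite_splx by simp
  moreover have "finite (homotopy_group X n x)" for n x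
  proof -
    have "finite (spheres X n x)"
      using finite_splx[of n] by (rule rev_finite_subset) (auto simp: spheres_def)
    then show ?thesis unfolding homotopy_group_def quotient_def by simp
  qed
  moreover have "is_singleton (homotopy_group X k x)" if "1 < k" "x \<in> splx X 0" for k x
    using spheres_trivial[OF that] unfolding is_singleton_def homotopy_group_def quotient_def by auto
  ultimately show ?thesis
    using kan_complex_X unfolding pi_finite_spaces_def truncated_def by blast
qed

end

section \<open>Loops in a Kan complex\<close>

text \<open>With \<open>A\<close> on \<open>[0, 2]\<close> and \<open>B\<close> on
  \<open>[1, 2]\<close>, the common target glues them to a horn at vertex 2. The third side of a
  filler represents \<open>A B\<^sup>-\<^sup>1\<close>.\<close>

lemma kan_complex_fill_outer:
  assumes P: "kan_complex P" and A: "A \<in> splx P 1" and B: "B \<in> splx P 1"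
    and target: "act P 1 [1] A = act P 1 [1] B"
  obtains y where "y \<in> splx P 2" "act P 2 [0, 2] y = A" "act P 2 [1, 2] y = B"
proof -
  have ss: "simplicial_set P" using P by (simp add: kan_complex_def)
  \<comment> \<open>Collapsing the vertices 0 and 1 identifies each of the edges
    \<open>[0, 2]\<close> and \<open>[1, 2]\<close> with the standard edge.\<close>
  define \<pi> :: "nat list" where "\<pi> = [0, 0, 1]"
  have \<pi>: "\<pi> \<in> mono_maps 2 1" by (auto simp: \<pi>_def mono_maps_def)
  have \<pi>_in: "mono_comp \<pi> \<sigma> \<in> mono_maps k 1" if "\<sigma> \<in> mono_maps k 2" for \<sigma> k
    using mono_comp_in[OF \<pi> that] .
  \<comment> \<open>A simplex of the horn omits 1 or 0 and goes to \<open>A\<close> or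
    \<open>B\<close> accordingly. If it omits both, it is constant at vertex 2, and
    \<open>vertex\<close> shows that the two choices agree.\<close>
  define f where "f k = restrict (\<lambda>\<sigma>. act P 1 (mono_comp \<pi> \<sigma>) (if 1 \<notin> set \<sigma> then A else B))
      (splx (horn 2 2) k)" for k
  have vertex: "act P 1 (mono_comp \<pi> \<sigma>) A = act P 1 (mono_comp \<pi> \<sigma>) B"
    if "\<sigma> \<in> mono_maps k 2" "0 \<notin> set \<sigma>" "1 \<notin> set \<sigma>" for k \<sigma>
  proof -
    have two: "x = 2" if "x \<in> set \<sigma>" for x
    proof -
      have "x \<le> 2" "x \<noteq> 0" "x \<noteq> 1"
        using mono_mapsD(3)[OF \<open>\<sigma> \<in> mono_maps k 2\<close>] that \<open>0 \<notin> set \<sigma>\<close> \<open>1 \<notin> set \<sigma>\<close>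
        by (blast, metis, metis)
      then show ?thesis by linarith
    qed
    have "\<pi> ! 2 = 1" by (simp add: \<pi>_def)
    then have "map ((!) \<pi>) \<sigma> = map (\<lambda>_. 1) \<sigma>"
      using two by (metis (mono_tags, lifting) map_cong)
    then have "mono_comp \<pi> \<sigma> = replicate (Suc k) 1"
      using mono_mapsD(1)[OF that(1)] by (metis mono_comp_def map_replicate_const)
    moreover have "mono_comp [1] (mono_const k 0) = replicate (Suc k) 1"
      by (simp add: mono_comp_def mono_const_def)
    ultimately have eq: "mono_comp \<pi> \<sigma> = mono_comp [1] (mono_const k 0)" by (simp only:)
    have "mono_const k 0 \<in> mono_maps k 0" "[1] \<in> mono_maps 0 1"
      by (auto simp: mono_maps_def mono_const_def)
    note factor = simplicial_set_act_act[OF ss this]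
    show ?thesis
      using factor[OF A] factor[OF B] target by (simp only: eq)
  qed
  have "f \<in> smap (horn 2 2) P"
    unfolding smap_def
  proof (intro CollectI conjI allI ballI)
    show "f k \<in> splx (horn 2 2) k \<rightarrow>\<^sub>E splx P k" for k
      using A B \<pi>_in simplicial_set_act_in[OF ss] by (auto simp: f_def horn_def)
  next
    fix m n \<theta> \<sigma> assume \<theta>: "\<theta> \<in> mono_maps m n" and \<sigma>: "\<sigma> \<in> splx (horn 2 2) n"
    then have \<sigma>m: "\<sigma> \<in> mono_maps n 2" and ex: "0 \<notin> set \<sigma> \<or> 1 \<notin> set \<sigma>"
      by (auto simp: horn_def le_Suc_eq eval_nat_numeral)
    have comp: "mono_comp \<sigma> \<theta> \<in> mono_maps m 2" using mono_comp_in \<sigma>m \<theta> by blast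
    have sub: "set (mono_comp \<sigma> \<theta>) \<subseteq> set \<sigma>"
    proof -
      have "\<sigma> ! i \<in> set \<sigma>" if "i \<in> set \<theta>" for i
        using mono_mapsD(3)[OF \<theta>] mono_mapsD(1)[OF \<sigma>m] that by auto
      then show ?thesis by (auto simp: mono_comp_def)
    qed
    have in_horn: "mono_comp \<sigma> \<theta> \<in> splx (horn 2 2) m"
      using sub comp \<sigma> by (auto simp: horn_def)
    have assoc: "mono_comp \<pi> (mono_comp \<sigma> \<theta>) = mono_comp (mono_comp \<pi> \<sigma>) \<theta>"
      using mono_mapsD(3)[OF \<theta>] mono_mapsD(1)[OF \<sigma>m] by (auto simp: mono_comp_def)
    have act: "act P 1 (mono_comp \<pi> (mono_comp \<sigma> \<theta>)) Z = act P n \<theta> (act P 1 (mono_comp \<pi> \<sigma>) Z)"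
      if "Z \<in> splx P 1" for Z
      using simplicial_set_act_act[OF ss \<theta> \<pi>_in[OF \<sigma>m] that] assoc by simp
    have "f m (mono_comp \<sigma> \<theta>) = act P n \<theta> (f n \<sigma>)"
    \<comment> \<open>The choice between \<open>A\<close> and \<open>B\<close> changes under
      \<open>\<theta>\<close> only when vertex 1 is dropped; what is left then lies over vertex
      2.\<close>
    proof (cases "1 \<in> set \<sigma> \<and> 1 \<notin> set (mono_comp \<sigma> \<theta>)")
      case True
      then have "0 \<notin> set (mono_comp \<sigma> \<theta>)" using ex sub by auto
      then show ?thesis
        using True in_horn \<sigma> act[OF B] vertex[OF comp] by (simp add: f_def)
    next
      case False
      then have "1 \<in> set (mono_comp \<sigma> \<theta>) \<longleftrightarrow> 1 \<in> set \<sigma>" using sub by auto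
      then show ?thesis
        using in_horn \<sigma> act[OF A] act[OF B] by (simp add: f_def)
    qed
    then show "f m (act (horn 2 2) n \<theta> \<sigma>) = act P n \<theta> (f n \<sigma>)"
      by (simp add: horn_def)
  qed
  then obtain g where g: "g \<in> smap (std_simplex 2) P"
    and gf: "\<And>k \<sigma>. \<sigma> \<in> splx (horn 2 2) k \<Longrightarrow> g k \<sigma> = f k \<sigma>"
  proof -
    have "\<exists>g\<in>smap (std_simplex 2) P. \<forall>k. \<forall>\<sigma>\<in>splx (horn 2 2) k. g k \<sigma> = f k \<sigma>"
      using P \<open>f \<in> smap (horn 2 2) P\<close> by (auto simp: kan_complex_def)
    then show thesis using that by blast
  qed
  have top: "[0, 1, 2] \<in> splx (std_simplex 2) 2" by (auto simp: std_simplex_def mono_maps_def)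
  have edge: "act P 2 [i, 2] (g 2 [0, 1, 2]) = (if i = 0 then A else B)" if "i = 0 \<or> i = 1" for i
  proof -
    have m: "[i, 2] \<in> mono_maps 1 2" using that by (auto simp: mono_maps_def)
    have "1 - i \<le> 2 \<and> 1 - i \<noteq> 2 \<and> 1 - i \<notin> set [i, 2]" using that by auto
    then have in_horn: "[i, 2] \<in> splx (horn 2 2) 1"
      using m unfolding horn_def by fastforce
    have "mono_comp [0, 1, 2] [i, 2] = [i, 2]" using that by (auto simp: mono_comp_def)
    then have "act P 2 [i, 2] (g 2 [0, 1, 2]) = g 1 [i, 2]"
      using smap_act[OF g m top] by (simp add: std_simplex_def)
    also have "g 1 [i, 2] = act P 1 (mono_comp \<pi> [i, 2]) (if i = 0 then A else B)"
      unfolding gf[OF in_horn] using in_horn that by (simp add: f_def) force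
    also have "mono_comp \<pi> [i, 2] = mono_id 1"
      using that by (auto simp: mono_comp_def \<pi>_def mono_id_def)
    finally show ?thesis using simplicial_set_act_id[OF ss] A B by simp
  qed
  show thesis
    using that[of "g 2 [0, 1, 2]"] smap_in[OF g top] edge[of 0] edge[of 1] by simp
qed

text \<open>
  From edges \<open>a\<close>, \<open>b\<close> with a common target, one horn filler gives \<open>a b\<^sup>-\<^sup>1\<close>, with label
  \<open>\<phi> a - \<phi> b\<close>. Iterating this on the loop \<open>A B\<^sup>-\<^sup>1\<close> of label \<open>1\<close> yields loops with every label
  modulo \<open>N\<close>, and \<open>\<phi>\<close> separates their homotopy classes.
\<close>

lemma card_homotopy_group_ge:
  fixes \<phi> :: "'a \<Rightarrow> int" and N :: nat
  assumes P: "kan_complex P" and x: "x \<in> splx P 0"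
    and fin: "finite (homotopy_group P 1 x)"
    and cocycle: "\<And>y. y \<in> splx P 2 \<Longrightarrow>
      \<phi> (act P 2 [0, 2] y) mod int N = (\<phi> (act P 2 [0, 1] y) + \<phi> (act P 2 [1, 2] y)) mod int N"
    and degenerate: "\<phi> (act P 0 [0, 0] x) mod int N = 0"
    and A: "A \<in> splx P 1" "act P 1 [0] A = x"
    and B: "B \<in> splx P 1" "act P 1 [0] B = x"
    and AB: "act P 1 [1] A = act P 1 [1] B" "(\<phi> A - \<phi> B) mod int N = 1 mod int N"
  shows "N \<le> card (homotopy_group P 1 x)"
proof -
  have ss: "simplicial_set P" using P by (simp add: kan_complex_def)
  have difference: "\<exists>l\<in>splx P 1. act P 1 [0] l = act P 1 [0] a \<and> act P 1 [1] l = act P 1 [0] b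
      \<and> \<phi> l mod int N = (\<phi> a - \<phi> b) mod int N"
    if ab: "a \<in> splx P 1" "b \<in> splx P 1" "act P 1 [1] a = act P 1 [1] b" for a b
  proof -
    obtain y where y: "y \<in> splx P 2" "act P 2 [0, 2] y = a" "act P 2 [1, 2] y = b"
      using kan_complex_fill_outer[OF P ab] .
    have m: "[0, 1] \<in> mono_maps 1 2" "[0, 2] \<in> mono_maps 1 2" "[1, 2] \<in> mono_maps 1 2"
      "[0] \<in> mono_maps 0 1" "[1] \<in> mono_maps 0 1"
      by (auto simp: mono_maps_def)
    have v: "act P 1 [i] (act P 2 [j, k] y) = act P 2 [[j, k] ! i] y"
      if "[i] \<in> mono_maps 0 1" "[j, k] \<in> mono_maps 1 2" for i j k
      using simplicial_set_act_act[OF ss that y(1)] by (simp add: mono_comp_def)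
    have "act P 1 [0] (act P 2 [0, 1] y) = act P 1 [0] a"
      using v[OF m(4) m(1)] v[OF m(4) m(2)] y by simp
    moreover have "act P 1 [1] (act P 2 [0, 1] y) = act P 1 [0] b"
      using v[OF m(5) m(1)] v[OF m(4) m(3)] y by simp
    moreover have "\<phi> (act P 2 [0, 1] y) mod int N = (\<phi> a - \<phi> b) mod int N"
      using cocycle[OF y(1)] y by (metis add_diff_cancel_right' mod_diff_left_eq)
    ultimately show ?thesis
      using simplicial_set_act_in[OF ss m(1) y(1)] by blast
  qed
  obtain l where l: "l \<in> splx P 1" "act P 1 [0] l = x" "act P 1 [1] l = x"
    "\<phi> l mod int N = 1 mod int N"
    using difference[OF A(1) B(1) AB(1)] A B AB by auto
  \<comment> \<open>Each step appends the inverse of \<open>l\<close>, so labels go down by 1,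
    starting from the label 0 of \<open>l l\<^sup>-\<^sup>1\<close>.\<close>
  have "\<exists>q\<in>splx P 1. act P 1 [0] q = x \<and> act P 1 [1] q = x \<and> \<phi> q mod int N = (- int k) mod int N" for k
  proof (induction k)
    case 0
    have "(\<phi> l - \<phi> l) mod int N = 0" by simp
    then show ?case using difference[OF l(1) l(1)] l by auto
  next
    case (Suc k)
    then obtain q where q: "q \<in> splx P 1" "act P 1 [0] q = x" "act P 1 [1] q = x"
      "\<phi> q mod int N = (- int k) mod int N" by blast
    have "(\<phi> q - \<phi> l) mod int N = (- int k - 1) mod int N"
      using q(4) l(4) by (rule mod_diff_cong)
    moreover have "- int (Suc k) = - int k - 1" by simp
    ultimately show ?case using difference[OF q(1) l(1)] q l by (metis (no_types, lifting))
  qed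
  then obtain q where q: "\<And>k. q k \<in> splx P 1" "\<And>k. act P 1 [0] (q k) = x"
    "\<And>k. act P 1 [1] (q k) = x" "\<And>k. \<phi> (q k) mod int N = (- int k) mod int N"
    by metis
  have x_id: "act P 0 [0] x = x"
    using simplicial_set_act_id[OF ss x] by (simp add: mono_id_def)
  have sphere: "q k \<in> spheres P 1 x" for k
    using q x_id by (auto simp: spheres_def face_def degenerate_at_def mono_const_def coface_1 le_Suc_eq)
  have refl: "(q k, q k) \<in> sphere_rel P 1 x" for k
  proof -
    \<comment> \<open>The degenerate triangle on \<open>q k\<close> along \<open>[0, 1, 1]\<close>
      is the witness: faces 1 and 2 are \<open>q k\<close>, and face 0 is degenerate at the endpoint
      \<open>x\<close>.\<close>
    have d: "[0, 1, 1] \<in> mono_maps 2 1" by (auto simp: mono_maps_def)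
    have a: "act P 2 [i, j] (act P 1 [0, 1, 1] (q k)) = act P 1 [[0, 1, 1] ! i, [0, 1, 1] ! j] (q k)"
      if "[i, j] \<in> mono_maps 1 2" for i j
      using simplicial_set_act_act[OF ss that d q(1)] by (simp add: mono_comp_def)
    have id: "act P 1 [0, 1] (q k) = q k"
      using simplicial_set_act_id[OF ss q(1)] by (simp add: mono_id_def)
    have "act P 1 [1, 1] (q k) = act P 0 [0, 0] (act P 1 [1] (q k))"
      using simplicial_set_act_act[OF ss, of "[0, 0]" 1 0 "[1]" 1 "q k"] q
      by (simp add: mono_comp_def mono_maps_def)
    then have "act P 1 [1, 1] (q k) = degenerate_at P 1 x"
      using q by (simp add: degenerate_at_def mono_const_def)
    then have "face P 2 0 (act P 1 [0, 1, 1] (q k)) = degenerate_at P 1 x"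
      "face P 2 1 (act P 1 [0, 1, 1] (q k)) = q k" "face P 2 2 (act P 1 [0, 1, 1] (q k)) = q k"
      using a[of 0 1] a[of 0 2] a[of 1 2] id by (simp_all add: face_def coface_2[unfolded One_nat_def] mono_maps_def)
    then show ?thesis
      using sphere simplicial_set_act_in[OF ss d q(1)]
      by (auto simp: sphere_rel_def numeral_2_eq_2 intro!: bexI[of _ "act P 1 [0, 1, 1] (q k)"])
  qed
  \<comment> \<open>Face 0 of the witnessing triangle has label 0, so the cocycle relation equates
    the labels of the other two faces.\<close>
  have invariant: "\<phi> a mod int N = \<phi> b mod int N" if ab: "(a, b) \<in> sphere_rel P 1 x" for a b
  proof -
    obtain y where y: "y \<in> splx P 2" "face P 2 1 y = a" "face P 2 2 y = b"
      "face P 2 0 y = degenerate_at P 1 x"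
      using ab by (auto simp: sphere_rel_def numeral_2_eq_2)
    then have "\<phi> a mod int N = (\<phi> b + \<phi> (act P 0 [0, 0] x)) mod int N"
      using cocycle[OF y(1)]
      by (simp add: face_def coface_2[unfolded One_nat_def] degenerate_at_def mono_const_def)
    also have "\<dots> = \<phi> b mod int N"
      using degenerate by (metis add.right_neutral mod_add_right_eq)
    finally show ?thesis .
  qed
  define cls where "cls k = sphere_rel P 1 x `` {q k}" for k
  have "inj_on cls {..<N}"
  proof (rule inj_onI)
    fix j k assume jk: "j \<in> {..<N}" "k \<in> {..<N}" "cls j = cls k"
    have "q k \<in> cls k" using refl by (simp add: cls_def)
    then have "(q j, q k) \<in> sphere_rel P 1 x" using jk(3) by (auto simp: cls_def)
    then have "(- int j) mod int N = (- int k) mod int N" using invariant q(4) by metis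
    then have "int j mod int N = int k mod int N" by (metis add.inverse_inverse mod_minus_cong)
    then show "j = k" using jk by simp
  qed
  moreover have "cls ` {..<N} \<subseteq> homotopy_group P 1 x"
    using sphere by (auto simp: cls_def homotopy_group_def quotient_def)
  ultimately show ?thesis
    using card_inj_on_le[OF _ _ fin, of cls "{..<N}"] by simp
qed

section \<open>Cocones on the span\<close>

text \<open>The edge \<open>E\<close> is the track of the point \<open>c\<close> under the homotopy \<open>F \<circ> G \<simeq> id\<close>.\<close>

lemma homotopy_equivalence_path:
  assumes "homotopy_equivalence K Y F" "c1 \<in> splx Y 1" "act Y 1 [0] c1 = c" "act Y 1 [1] c1 = c"
    "c \<in> splx Y 0"
  obtains q E where "q \<in> splx K 0" "E \<in> splx Y 1" "act Y 1 [0] E = F 0 q" "act Y 1 [1] E = c"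
proof -
  obtain G H where G: "G \<in> smap Y K"
    and H: "homotopy_between Y Y H (\<lambda>k y. F k (G k y)) (\<lambda>k y. y)"
    using assms(1) by (auto simp: homotopy_equivalence_def)
  then have Hs: "H \<in> smap (sprod Y (std_simplex 1)) Y" by (simp add: homotopy_between_def)
  have ends: "H 0 (c, [0]) = F 0 (G 0 c)" "H 0 (c, [1]) = c"
  proof -
    have "H 0 (cyl_end Y 0 0 c) = F 0 (G 0 c)" "H 0 (cyl_end Y 1 0 c) = c"
      using H assms(5) unfolding homotopy_between_def by blast+
    then show "H 0 (c, [0]) = F 0 (G 0 c)" "H 0 (c, [1]) = c"
      using assms(5) by (simp_all add: cyl_end_def mono_const_def)
  qed
  \<comment> \<open>The loop \<open>c1\<close> stands in for the degenerate edge at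
    \<open>c\<close>: paired with \<open>[0, 1]\<close> it runs from \<open>(c, [0])\<close> to
    \<open>(c, [1])\<close>, and \<open>E\<close> is its image under \<open>H\<close>.\<close>
  have c1: "(c1, [0, 1]) \<in> splx (sprod Y (std_simplex 1)) 1"
    using assms(2) by (auto simp: sprod_def std_simplex_def mono_maps_def)
  have "act Y 1 [i] (H 1 (c1, [0, 1])) = H 0 (c, [i])" if "i = 0 \<or> i = 1" for i
  proof -
    have "[i] \<in> mono_maps 0 1" using that by (auto simp: mono_maps_def)
    from smap_act[OF Hs this c1] show ?thesis
      using that assms(3,4) by (auto simp: sprod_def std_simplex_def mono_comp_def)
  qed
  then show thesis
    using that[of "G 0 c" "H 1 (c1, [0, 1])"] smap_in[OF G assms(5)] smap_in[OF Hs c1] ends by simp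
qed

section \<open>The loop cocone with vertex the nerve\<close>

context label_encoding
begin

text \<open>The homotopy is the edge labelled \<open>1\<close> at \<open>s\<close> and constant elsewhere.\<close>

definition loop_cocone_homotopy ::
    "'c \<Rightarrow> 'c set \<Rightarrow> nat \<Rightarrow> nat \<Rightarrow> ('c \<times> nat list) \<times> nat list \<Rightarrow> 'u" where
  "loop_cocone_homotopy s S n k =
     restrict (\<lambda>((c, \<sigma>), \<tau>). e (normalize_labels M (map (\<lambda>i. if c = s then int i else 0) \<sigma>)))
       (splx (sprod (sprod (discrete S) (std_simplex 1)) (std_simplex n)) k)"

text \<open>The zeros are written as a normalized \<open>map\<close> so that
  \<open>act_simplex\<close> applies.\<close>

definition constant_leg :: "'c set \<Rightarrow> nat \<Rightarrow> nat \<Rightarrow> 'c \<times> nat list \<Rightarrow> 'u" where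
  "constant_leg S n k =
     restrict (\<lambda>(c, \<tau>). e (normalize_labels M (map (\<lambda>i. 0) \<tau>))) (splx (sprod (discrete S) (std_simplex n)) k)"

lemma loop_cocone_homotopy_smap:
  "loop_cocone_homotopy s S n \<in> smap (sprod (sprod (discrete S) (std_simplex 1)) (std_simplex n)) X"
  unfolding smap_def
proof (intro CollectI conjI allI ballI)
  show "loop_cocone_homotopy s S n k \<in>
      splx (sprod (sprod (discrete S) (std_simplex 1)) (std_simplex n)) k \<rightarrow>\<^sub>E splx X k" for k
    by (auto simp: loop_cocone_homotopy_def sprod_def std_simplex_def dest: mono_mapsD intro!: simplex_in)
next
  fix m k \<theta> z
  assume \<theta>: "\<theta> \<in> mono_maps m k"
    and z: "z \<in> splx (sprod (sprod (discrete S) (std_simplex 1)) (std_simplex n)) k"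
  obtain c \<sigma> \<tau> where z': "z = ((c, \<sigma>), \<tau>)" by (metis surj_pair)
  then have m: "c \<in> S" "\<sigma> \<in> mono_maps k 1" "\<tau> \<in> mono_maps k n"
    using z by (auto simp: sprod_def std_simplex_def discrete_def)
  then show "loop_cocone_homotopy s S n m
      (act (sprod (sprod (discrete S) (std_simplex 1)) (std_simplex n)) k \<theta> z) =
      act X k \<theta> (loop_cocone_homotopy s S n k z)"
    using act_simplex[OF mono_mapsD(1)[OF m(2)] \<theta>] mono_comp_in[OF m(2) \<theta>] mono_comp_in[OF m(3) \<theta>]
    by (simp add: loop_cocone_homotopy_def z' sprod_def std_simplex_def discrete_def)
qed

lemma constant_leg_smap:
  "constant_leg S n \<in> smap (sprod (discrete S) (std_simplex n)) X"
  unfolding smap_def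
proof (intro CollectI conjI allI ballI)
  show "constant_leg S n k \<in> splx (sprod (discrete S) (std_simplex n)) k \<rightarrow>\<^sub>E splx X k" for k
    by (auto simp: constant_leg_def sprod_def std_simplex_def dest: mono_mapsD intro!: simplex_in)
next
  fix m k \<theta> z
  assume \<theta>: "\<theta> \<in> mono_maps m k" and z: "z \<in> splx (sprod (discrete S) (std_simplex n)) k"
  obtain c \<tau> where z': "z = (c, \<tau>)" by (metis surj_pair)
  then have m: "c \<in> S" "\<tau> \<in> mono_maps k n"
    using z by (auto simp: sprod_def std_simplex_def discrete_def)
  then show "constant_leg S n m (act (sprod (discrete S) (std_simplex n)) k \<theta> z) =
      act X k \<theta> (constant_leg S n k z)"
    using act_simplex[OF mono_mapsD(1)[OF m(2)] \<theta>] mono_comp_in[OF m(2) \<theta>]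
    by (simp add: constant_leg_def z' sprod_def std_simplex_def discrete_def)
qed

text \<open>At either end of the homotopy the labelling is constant along each simplex, whatever
  \<open>c\<close> is, so it normalizes to 0 and matches the constant legs.\<close>

lemma loop_cocone_in:
  fixes S :: "'b set"
  shows "(constant_leg {p} n, loop_cocone_homotopy s S n, constant_leg {p} n) \<in>
     splx (cocone_space (discrete S) (discrete {p}) (discrete {p})
       (discrete_map S (\<lambda>_. p)) (discrete_map S (\<lambda>_. p)) X) n"
proof -
  have eq: "precomp (discrete S) (cyl_end (discrete S) i) n (loop_cocone_homotopy s S n) =
      precomp (discrete S) (discrete_map S (\<lambda>_. p)) n (constant_leg {p} n)" if "i \<le> 1" for i
  proof (intro ext)
    fix k :: nat and z :: "'b \<times> nat list"
    obtain c \<tau> where z: "z = (c, \<tau>)" by (metis surj_pair)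
    have const: "mono_const k i \<in> mono_maps k 1"
      using that by (auto simp: mono_const_def mono_maps_def)
    have "normalize_labels M (map (\<lambda>j. if c = s then int j else 0) (mono_const k i)) =
        normalize_labels M (map (\<lambda>j. 0) \<tau>)" if "length \<tau> = Suc k"
      using that normalize_const[of "mono_const k i" "\<lambda>j. if c = s then int j else 0" "if c = s then int i else 0" M]
        normalize_const[of \<tau> "\<lambda>j. 0" 0 M]
      by (simp add: mono_const_def del: replicate_Suc)
    then show "precomp (discrete S) (cyl_end (discrete S) i) n (loop_cocone_homotopy s S n) k z =
        precomp (discrete S) (discrete_map S (\<lambda>_. p)) n (constant_leg {p} n) k z"
      using const by (auto simp: precomp_def z cyl_end_def discrete_def discrete_map_def sprod_def
          std_simplex_def loop_cocone_homotopy_def constant_leg_def restrict_def dest: mono_mapsD)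
  qed
  show ?thesis
    using eq[of 0] eq[of 1]
    by (simp add: cocone_space_def mapping_space_def loop_cocone_homotopy_smap constant_leg_smap
        del: One_nat_def)
qed

text \<open>All three components ignore the simplex coordinate. The edge is thus a constant path and
  can serve as \<open>c1\<close> in \<open>homotopy_equivalence_path\<close>.\<close>

lemma loop_cocone_vertex:
  assumes "i \<le> 1"
  shows "act (cocone_space (discrete S) (discrete {p}) (discrete {p}) f g X) 1 [i]
       (constant_leg {p} 1, loop_cocone_homotopy s S 1, constant_leg {p} 1) =
     (constant_leg {p} 0, loop_cocone_homotopy s S 0, constant_leg {p} 0)"
proof -
  have i: "[i] \<in> mono_maps 0 1" using assms by (auto simp: mono_maps_def)
  note comp = mono_comp_in[OF i]
  have len: "normalize_labels M (map (\<lambda>j. 0) (mono_comp [i] \<tau>)) = normalize_labels M (map (\<lambda>j. 0) \<tau>)" for \<tau>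
    by (simp add: mono_comp_def comp_def)
  show ?thesis
    using comp len
    by (auto simp: cocone_space_def mapping_space_def constant_leg_def loop_cocone_homotopy_def sprod_def
        std_simplex_def discrete_def restrict_def fun_eq_iff)
qed

text \<open>Both sums are the label of the diagonal of the square over \<open>c\<close>, read off
  from its two triangles.\<close>

lemma square_labels:
  assumes w: "w \<in> smap (sprod (sprod (discrete S) (std_simplex 1)) (std_simplex 1)) X" and c: "c \<in> S"
  shows "(edge_label e (w 1 ((c, [0, 1]), [0, 0])) + edge_label e (w 1 ((c, [1, 1]), [0, 1]))) mod M =
         (edge_label e (w 1 ((c, [0, 0]), [0, 1])) + edge_label e (w 1 ((c, [0, 1]), [1, 1]))) mod M"
proof -
  let ?Q = "sprod (sprod (discrete S) (std_simplex 1)) (std_simplex 1)"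
  have tri: "edge_label e (w 1 (act ?Q 2 [0, 2] z)) mod M =
      (edge_label e (w 1 (act ?Q 2 [0, 1] z)) + edge_label e (w 1 (act ?Q 2 [1, 2] z))) mod M"
    if z: "z \<in> splx ?Q 2" for z
  proof -
    have m: "[0, 1] \<in> mono_maps 1 2" "[0, 2] \<in> mono_maps 1 2" "[1, 2] \<in> mono_maps 1 2"
      by (auto simp: mono_maps_def)
    show ?thesis
      using edge_label_cocycle[of "w 2 z"] m[THEN smap_act[OF w _ z]] by simp
  qed
  have z: "((c, [0, 1, 1]), [0, 0, 1]) \<in> splx ?Q 2" "((c, [0, 0, 1]), [0, 1, 1]) \<in> splx ?Q 2"
    using c by (auto simp: sprod_def discrete_def std_simplex_def mono_maps_def)
  from tri[OF z(1)] tri[OF z(2)] show ?thesis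
    by (simp add: sprod_def discrete_def std_simplex_def mono_comp_def numeral_2_eq_2)
qed

end

text \<open>
  A pushout would carry a map to \<open>K(\<int>/M, 1)\<close> that is a generator on the loop \<open>h\<^sub>s h\<^sub>t\<^sup>-\<^sup>1\<close>, for every \<open>M\<close>.
\<close>

lemma pushout_cocycle:
  fixes p s t :: 'u and M :: int
  assumes inf: "infinite (UNIV :: 'u set)" and st: "s \<noteq> t" and M: "M > 0"
    and po: "is_pushout_in pi_finite_spaces (discrete {s, t}) (discrete {p}) (discrete {p})
           (discrete_map {s, t} (\<lambda>_. p)) (discrete_map {s, t} (\<lambda>_. p)) P a h b"
  obtains \<phi> :: "'u \<Rightarrow> int" where
    "\<And>y. y \<in> splx P 2 \<Longrightarrow>
      \<phi> (act P 2 [0, 2] y) mod M = (\<phi> (act P 2 [0, 1] y) + \<phi> (act P 2 [1, 2] y)) mod M"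
    "\<And>x. x \<in> splx P 0 \<Longrightarrow> \<phi> (act P 0 [0, 0] x) mod M = 0"
    "(\<phi> (h 1 (s, [0, 1])) - \<phi> (h 1 (t, [0, 1]))) mod M = 1 mod M"
proof -
  \<comment> \<open>The infinite type contains a copy of the naturals and hence of the countable
    type of integer lists, so the nerve can be built over it.\<close>
  obtain \<iota> :: "nat \<Rightarrow> 'u" where "inj \<iota>"
    using infinite_countable_subset[OF inf] by blast
  then have "inj (\<iota> \<circ> (to_nat :: int list \<Rightarrow> nat))" by (simp add: inj_compose)
  then obtain e :: "int list \<Rightarrow> 'u" where "inj e" by blast
  then interpret label_encoding e M using M by unfold_locales
  let ?C = "discrete {s, t}" and ?A = "discrete {p}" and ?f = "discrete_map {s, t} (\<lambda>_. p)"
  let ?Y = "cocone_space ?C ?A ?A ?f ?f X"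
  let ?F = "cocone_comparison ?C ?A ?A P a h b X"
  have heq: "homotopy_equivalence (mapping_space P X) ?Y ?F"
    using po pi_finite_X by (simp add: is_pushout_in_def)
  \<comment> \<open>The loop cocone is induced by a map out of \<open>P\<close> only up to a path:
    \<open>E\<close> leads to it from the cocone induced by \<open>q\<close>.\<close>
  obtain q E where q: "q \<in> splx (mapping_space P X) 0" and E: "E \<in> splx ?Y 1"
    and E0: "act ?Y 1 [0] E = ?F 0 q"
    and E1: "act ?Y 1 [1] E = (constant_leg {p} 0, loop_cocone_homotopy s {s, t} 0, constant_leg {p} 0)"
    using homotopy_equivalence_path[OF heq loop_cocone_in loop_cocone_vertex loop_cocone_vertex loop_cocone_in]
    by (metis le_refl zero_le)
  have qs: "q \<in> smap (sprod P (std_simplex 0)) X" using q by (simp add: mapping_space_def)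
  obtain u w v where uwv: "E = (u, w, v)" by (metis surj_pair)
  have w: "w \<in> smap (sprod (sprod ?C (std_simplex 1)) (std_simplex 1)) X"
    and glue0: "precomp ?C (cyl_end ?C 0) 1 w = precomp ?C ?f 1 u"
    and glue1: "precomp ?C (cyl_end ?C 1) 1 w = precomp ?C ?f 1 v"
    using E by (auto simp: uwv cocone_space_def mapping_space_def)
  \<comment> \<open>This pulls the labels back along \<open>q\<close>; \<open>[0, 0]\<close> is the
    only edge of \<open>std_simplex 0\<close>.\<close>
  define \<phi> where "\<phi> z = edge_label e (q 1 (z, [0, 0]))" for z
  \<comment> \<open>In the direction of the path \<open>E\<close>, the sides of the square factor
    through the legs \<open>u\<close> and \<open>v\<close> at \<open>p\<close>, so they are the same
    for \<open>s\<close> and \<open>t\<close>.\<close>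
  have side0: "w 1 ((c, [0, 0]), [0, 1]) = u 1 (p, [0, 1])"
    and side1: "w 1 ((c, [1, 1]), [0, 1]) = v 1 (p, [0, 1])" if "c \<in> {s, t}" for c
    using fun_cong[OF fun_cong[OF glue0, of 1], of "(c, [0, 1])"]
      fun_cong[OF fun_cong[OF glue1, of 1], of "(c, [0, 1])"] that
    by (auto simp: precomp_def sprod_def discrete_def std_simplex_def mono_maps_def cyl_end_def
        mono_const_def discrete_map_def)
  \<comment> \<open>At the start of \<open>E\<close> the homotopy is \<open>h\<close> followed by
    \<open>q\<close>.\<close>
  have bottom: "w 1 ((c, [0, 1]), [0, 0]) = q 1 (h 1 (c, [0, 1]), [0, 0])" if "c \<in> {s, t}" for c
  proof -
    have "act (mapping_space (sprod ?C (std_simplex 1)) X) 1 [0] w = precomp (sprod ?C (std_simplex 1)) h 0 q"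
      using E0 q by (simp add: uwv cocone_space_def cocone_comparison_def)
    from fun_cong[OF fun_cong[OF this, of 1], of "((c, [0, 1]), [0, 0])"] that show ?thesis
      by (auto simp: mapping_space_def precomp_def sprod_def discrete_def std_simplex_def
          mono_maps_def mono_comp_def)
  qed
  \<comment> \<open>At the end of \<open>E\<close> it is the loop cocone, with label 1 at
    \<open>s\<close> and 0 at \<open>t\<close>.\<close>
  have top: "edge_label e (w 1 ((c, [0, 1]), [1, 1])) mod M = (if c = s then 1 else 0) mod M"
    if "c \<in> {s, t}" for c
  proof -
    have "act (mapping_space (sprod ?C (std_simplex 1)) X) 1 [1] w = loop_cocone_homotopy s {s, t} 0"
      using E1 by (simp add: uwv cocone_space_def)
    from fun_cong[OF fun_cong[OF this, of 1], of "((c, [0, 1]), [0, 0])"] that show ?thesis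
      by (auto simp: mapping_space_def loop_cocone_homotopy_def sprod_def discrete_def std_simplex_def
          mono_maps_def mono_comp_def edge_label_def normalize_labels_def)
  qed
  have square: "(\<phi> (h 1 (c, [0, 1])) + edge_label e (v 1 (p, [0, 1]))) mod M =
      (edge_label e (u 1 (p, [0, 1])) + (if c = s then 1 else 0)) mod M" if "c \<in> {s, t}" for c
    using square_labels[OF w that] top[OF that]
    by (metis (no_types, lifting) \<phi>_def bottom mod_add_right_eq side0 side1 that)
  \<comment> \<open>Subtracting the relation for \<open>t\<close> from that for \<open>s\<close>
    cancels the shared sides.\<close>
  have "((\<phi> (h 1 (s, [0, 1])) + edge_label e (v 1 (p, [0, 1]))) -
      (\<phi> (h 1 (t, [0, 1])) + edge_label e (v 1 (p, [0, 1])))) mod M =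
      ((edge_label e (u 1 (p, [0, 1])) + 1) - edge_label e (u 1 (p, [0, 1]))) mod M"
    using square[of s] square[of t] st by (intro mod_diff_cong) auto
  then have generator: "(\<phi> (h 1 (s, [0, 1])) - \<phi> (h 1 (t, [0, 1]))) mod M = 1 mod M"
    by simp
  have q_act: "q 1 (act P n \<theta> y, [0, 0]) = act X n \<theta> (q n (y, mono_const n 0))"
    if "y \<in> splx P n" "\<theta> \<in> mono_maps 1 n" for y n \<theta>
  proof -
    have "(y, mono_const n 0) \<in> splx (sprod P (std_simplex 0)) n"
      using that by (auto simp: sprod_def std_simplex_def mono_maps_def mono_const_def)
    note smap_act[OF qs that(2) this]
    moreover have "mono_comp (mono_const n 0) \<theta> = map (\<lambda>_. 0) \<theta>"
      using mono_mapsD(3)[OF that(2)] unfolding mono_comp_def mono_const_def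
      by (intro map_cong) (auto simp del: replicate_Suc simp: less_Suc_eq_le)
    then have "mono_comp (mono_const n 0) \<theta> = [0, 0]"
      using mono_mapsD(1)[OF that(2)] by (simp add: map_replicate_const)
    ultimately show ?thesis by (simp add: sprod_def std_simplex_def)
  qed
  have "\<phi> (act P 2 [0, 2] y) mod M = (\<phi> (act P 2 [0, 1] y) + \<phi> (act P 2 [1, 2] y)) mod M"
    if y: "y \<in> splx P 2" for y
  proof -
    have m: "[0, 1] \<in> mono_maps 1 2" "[0, 2] \<in> mono_maps 1 2" "[1, 2] \<in> mono_maps 1 2"
      by (auto simp: mono_maps_def)
    show ?thesis
      using edge_label_cocycle[of "q 2 (y, mono_const 2 0)"] m[THEN q_act[OF y]] by (simp add: \<phi>_def)
  qed
  moreover have "\<phi> (act P 0 [0, 0] x) mod M = 0" if "x \<in> splx P 0" for x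
    using q_act[OF that, of "[0, 0]"] by (simp add: \<phi>_def mono_maps_def edge_label_act)
  ultimately show thesis using that generator by blast
qed

theorem proposition2p3p1:
  fixes p s t :: 'u
  assumes "infinite (UNIV :: 'u set)"
    and "s \<noteq> t"
  shows "\<not> has_pushout_in (pi_finite_spaces :: 'u sset set)
           (discrete {s, t}) (discrete {p}) (discrete {p})
           (discrete_map {s, t} (\<lambda>_. p)) (discrete_map {s, t} (\<lambda>_. p))"
proof
  assume "has_pushout_in (pi_finite_spaces :: 'u sset set)
           (discrete {s, t}) (discrete {p}) (discrete {p})
           (discrete_map {s, t} (\<lambda>_. p)) (discrete_map {s, t} (\<lambda>_. p))"
  then obtain P a h b where po: "is_pushout_in pi_finite_spaces (discrete {s, t}) (discrete {p}) (discrete {p})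
           (discrete_map {s, t} (\<lambda>_. p)) (discrete_map {s, t} (\<lambda>_. p)) P a h b"
    by (auto simp: has_pushout_in_def)
  define x where "x = a 0 p"
  have P: "kan_complex P" and a: "a \<in> smap (discrete {p}) P"
    and h: "h \<in> smap (sprod (discrete {s, t}) (std_simplex 1)) P"
    and H: "homotopy_between (discrete {s, t}) P h (\<lambda>k c. a k (discrete_map {s, t} (\<lambda>_. p) k c))
      (\<lambda>k c. b k (discrete_map {s, t} (\<lambda>_. p) k c))"
    using po by (auto simp: is_pushout_in_def pi_finite_spaces_def homotopy_between_def)
  have ends: "h 0 (c, [0]) = x \<and> h 0 (c, [1]) = b 0 p" if c: "c \<in> {s, t}" for c
  proof -
    have "c \<in> splx (discrete {s, t}) 0" using c by (simp add: discrete_def)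
    moreover from this have "h 0 (cyl_end (discrete {s, t}) 0 0 c) = a 0 (discrete_map {s, t} (\<lambda>_. p) 0 c)"
      "h 0 (cyl_end (discrete {s, t}) 1 0 c) = b 0 (discrete_map {s, t} (\<lambda>_. p) 0 c)"
      using H unfolding homotopy_between_def by blast+
    ultimately show ?thesis
      using c by (simp add: cyl_end_def mono_const_def discrete_map_def x_def)
  qed
  have x: "x \<in> splx P 0" using smap_in[OF a, of p 0] by (simp add: x_def discrete_def)
  have fin: "finite (homotopy_group P 1 x)"
    using po x by (auto simp: is_pushout_in_def pi_finite_spaces_def)
  \<comment> \<open>One more than the order of \<open>\<pi>\<^sub>1\<close> at \<open>x\<close>; in
    particular positive, as \<open>pushout_cocycle\<close> requires.\<close>
  define N where "N = Suc (card (homotopy_group P 1 x))"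
  obtain \<phi> :: "'u \<Rightarrow> int" where \<phi>:
    "\<And>y. y \<in> splx P 2 \<Longrightarrow>
      \<phi> (act P 2 [0, 2] y) mod int N = (\<phi> (act P 2 [0, 1] y) + \<phi> (act P 2 [1, 2] y)) mod int N"
    "\<And>x. x \<in> splx P 0 \<Longrightarrow> \<phi> (act P 0 [0, 0] x) mod int N = 0"
    "(\<phi> (h 1 (s, [0, 1])) - \<phi> (h 1 (t, [0, 1]))) mod int N = 1 mod int N"
    using pushout_cocycle[OF assms _ po, of "int N"] by (auto simp: N_def)
  \<comment> \<open>The homotopy gives parallel edges over \<open>s\<close> and \<open>t\<close>,
    which serve as \<open>A\<close> and \<open>B\<close> in the counting lemma.\<close>
  have edge: "h 1 (c, [0, 1]) \<in> splx P 1 \<and> act P 1 [0] (h 1 (c, [0, 1])) = x \<and>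
      act P 1 [1] (h 1 (c, [0, 1])) = b 0 p" if c: "c \<in> {s, t}" for c
  proof -
    have m: "[0] \<in> mono_maps 0 1" "[1] \<in> mono_maps 0 1" by (auto simp: mono_maps_def)
    have z: "(c, [0, 1]) \<in> splx (sprod (discrete {s, t}) (std_simplex 1)) 1"
      using c by (auto simp: sprod_def discrete_def std_simplex_def mono_maps_def)
    show ?thesis
      using smap_in[OF h z] m[THEN smap_act[OF h _ z]] ends[OF c]
      by (simp add: sprod_def discrete_def std_simplex_def mono_comp_def)
  qed
  have "N \<le> card (homotopy_group P 1 x)"
    using card_homotopy_group_ge[OF P x fin, of \<phi> N "h 1 (s, [0, 1])" "h 1 (t, [0, 1])"] \<phi> x
      edge[of s] edge[of t] by simp
  then show False by (simp add: N_def)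
qed

end
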